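(* Let $(e_n)_{n=1}^\infty$ be an orthonormal basis for an infinite-dimensional complex Hilbert space $\mathcal{H}$. For each $m\in\mathbb{N}$ let $V_m=\mathrm{span}\{e_1,\dots,e_m\}$ and let $P_m:\mathcal{H}\to V_m$ be the orthogonal projection. Let $(\alpha_n)_{n=1}^\infty$ be a sequence decreasing to $0$ with $\sum_{n=2}^\infty\alpha_n<1/200$, and let $(\beta_n)_{n=1}^\infty$ be a sequence decreasing to $0$ with $\beta_n<2^{-1}\alpha_n^2$ for all $n\in\mathbb{N}$. Consider the frame $\Phi$ of $\mathcal{H}$ consisting of $e_1$ together with $(\varphi_{n,1})_{n=2}^\infty$ and $(\varphi_{n,i})_{n=2}^\infty$, where $\varphi_{n,1}=\alpha_ne_1+e_n$ and $\varphi_{n,i}=\alpha_ne_1+ie_n$ for all $n\geq2$ (here $i$ is the imaginary unit). Define $$\mathcal{B}=\{f\in\mathcal{H}:\ \|f-P_mf\|\leq\beta_{m+1}\|f\|\ \text{ for every } m\in\mathbb{N}\}.$$ Then for all $f,g\in\mathcal{B}$ we have $$\inf_{|\alpha|=1}\|f-\alpha g\|\leq5\,\|\mathcal{A}_\Phi(f)-\mathcal{A}_\Phi(g)\|.$$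
   Context: For a frame $\Phi=(\phi_k)_{k\in I}$ of $\mathcal{H}$ (a family with $A\|f\|^2\leq\sum_k|\langle f,\phi_k\rangle|^2\leq B\|f\|^2$ for all $f\in\mathcal{H}$, for some constants $A,B>0$), $\mathcal{A}_\Phi(f)=(|\langle f,\phi_k\rangle|)_{k\in I}\in\ell_2(I)$, and $\|\mathcal{A}_\Phi(f)-\mathcal{A}_\Phi(g)\|$ is the $\ell_2(I)$ norm. The infimum is over complex scalars $\alpha$ of modulus one. *)

theory Defs
  imports "HOL-Analysis.Analysis"
begin

section \<open>Complex Hilbert spaces\<close>

text \<open>
  The inner product is linear in the first argument. The real scalar multiplication, norm and
  topology are inherited from the class \<open>real_normed_vector\<close> and tied to the complex structure by
  the first and the last axiom; the last axiom also yields positive definiteness.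
\<close>

class complex_inner = real_normed_vector +
  fixes scaleC :: "complex \<Rightarrow> 'a \<Rightarrow> 'a"  (infixr \<open>*\<^sub>C\<close> 75)
    and cinner :: "'a \<Rightarrow> 'a \<Rightarrow> complex"
  assumes scaleR_scaleC: "r *\<^sub>R x = of_real r *\<^sub>C x"
    and scaleC_add_right: "c *\<^sub>C (x + y) = c *\<^sub>C x + c *\<^sub>C y"
    and scaleC_add_left: "(c + d) *\<^sub>C x = c *\<^sub>C x + d *\<^sub>C x"
    and scaleC_scaleC: "c *\<^sub>C d *\<^sub>C x = (c * d) *\<^sub>C x"
    and cinner_commute: "cinner x y = cnj (cinner y x)"
    and cinner_add_left: "cinner (x + y) z = cinner x z + cinner y z"
    and cinner_scaleC_left: "cinner (c *\<^sub>C x) y = c * cinner x y"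
    and cinner_self: "cinner x x = of_real ((norm x)\<^sup>2)"

class chilbert_space = complex_inner + complete_space

instantiation complex :: chilbert_space
begin

definition scaleC_complex :: "complex \<Rightarrow> complex \<Rightarrow> complex" where
  "scaleC_complex c x = c * x"

definition cinner_complex :: "complex \<Rightarrow> complex \<Rightarrow> complex" where
  "cinner_complex x y = x * cnj y"

instance
proof
  fix x :: complex
  show "cinner x x = of_real ((norm x)\<^sup>2)"
    by (simp only: cinner_complex_def complex_norm_square)
qed (auto simp: scaleC_complex_def cinner_complex_def scaleR_conv_of_real algebra_simps)

end

lemma vector_space_scaleC: "vector_space (scaleC :: complex \<Rightarrow> 'a::complex_inner \<Rightarrow> 'a)"
proof
  show "1 *\<^sub>C x = x" for x :: 'a
    using scaleR_scaleC[of 1 x] by simp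
qed (simp_all add: scaleC_add_right scaleC_add_left scaleC_scaleC)

global_interpretation complex_vector: vector_space "scaleC :: complex \<Rightarrow> 'a::complex_inner \<Rightarrow> 'a"
  defines cspan = complex_vector.span
  by (rule vector_space_scaleC)

definition orthonormal_basis :: "'k set \<Rightarrow> ('k \<Rightarrow> 'a::complex_inner) \<Rightarrow> bool" where
  "orthonormal_basis I e \<longleftrightarrow>
     (\<forall>j\<in>I. \<forall>k\<in>I. cinner (e j) (e k) = (if j = k then 1 else 0)) \<and>
     closure (cspan (e ` I)) = UNIV"

text \<open>Well defined at every vector when \<open>V\<close> is a closed complex subspace of a Hilbert space.\<close>

definition orth_proj :: "'a::complex_inner set \<Rightarrow> 'a \<Rightarrow> 'a" where
  "orth_proj V f = (THE p. p \<in> V \<and> (\<forall>v\<in>V. cinner (f - p) v = 0))"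


section \<open>Frames and phaseless measurements\<close>

definition is_frame :: "'k set \<Rightarrow> ('k \<Rightarrow> 'a::complex_inner) \<Rightarrow> bool" where
  "is_frame I \<Phi> \<longleftrightarrow>
     (\<exists>A>0. \<exists>B>0. \<forall>f.
        (\<lambda>k. (cmod (cinner f (\<Phi> k)))\<^sup>2) summable_on I \<and>
        A * (norm f)\<^sup>2 \<le> (\<Sum>\<^sub>\<infinity>k\<in>I. (cmod (cinner f (\<Phi> k)))\<^sup>2) \<and>
        (\<Sum>\<^sub>\<infinity>k\<in>I. (cmod (cinner f (\<Phi> k)))\<^sup>2) \<le> B * (norm f)\<^sup>2)"

definition meas :: "('k \<Rightarrow> 'a::complex_inner) \<Rightarrow> 'a \<Rightarrow> 'k \<Rightarrow> real" where
  "meas \<Phi> f k = cmod (cinner f (\<Phi> k))"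

text \<open>
  Meaningful only for square-summable families, since \<open>infsum\<close> is 0 otherwise. The measurements
  of a frame, and hence their differences, are square-summable.
\<close>

definition ell2_norm :: "'k set \<Rightarrow> ('k \<Rightarrow> real) \<Rightarrow> real" where
  "ell2_norm I a = sqrt (\<Sum>\<^sub>\<infinity>k\<in>I. (a k)\<^sup>2)"

lemma frame_meas_diff_square_summable:
  assumes "is_frame I \<Phi>"
  shows "(\<lambda>k. (meas \<Phi> f k - meas \<Phi> g k)\<^sup>2) summable_on I"
proof -
  have s: "(\<lambda>k. (meas \<Phi> h k)\<^sup>2) summable_on I" for h
    using assms unfolding is_frame_def meas_def by blast
  show ?thesis
  proof (rule summable_on_comparison_test)
    show "(\<lambda>k. 2 * ((meas \<Phi> f k)\<^sup>2 + (meas \<Phi> g k)\<^sup>2)) summable_on I"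
      by (intro summable_on_cmult_right summable_on_add s)
    show "(meas \<Phi> f k - meas \<Phi> g k)\<^sup>2 \<le> 2 * ((meas \<Phi> f k)\<^sup>2 + (meas \<Phi> g k)\<^sup>2)" for k
      using zero_le_power2[of "meas \<Phi> f k + meas \<Phi> g k"]
      by (simp add: power2_sum power2_diff)
  qed simp
qed


section \<open>The frame and the set of vectors in question\<close>

text \<open>
  \<open>Re_idx n\<close> and \<open>Im_idx n\<close> are the indices $(n,1)$ and $(n,i)$, where $i$ is the imaginary unit
  and $n \ge 2$.
\<close>

datatype frame_idx = Base_idx | Re_idx nat | Im_idx nat

definition frame_idxs :: "frame_idx set" where
  "frame_idxs = {Base_idx} \<union> Re_idx ` {2..} \<union> Im_idx ` {2..}"

fun frame_vec :: "(nat \<Rightarrow> 'a::complex_inner) \<Rightarrow> (nat \<Rightarrow> real) \<Rightarrow> frame_idx \<Rightarrow> 'a" where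
  "frame_vec e \<alpha> Base_idx = e 1"
| "frame_vec e \<alpha> (Re_idx n) = of_real (\<alpha> n) *\<^sub>C e 1 + e n"
| "frame_vec e \<alpha> (Im_idx n) = of_real (\<alpha> n) *\<^sub>C e 1 + \<i> *\<^sub>C e n"

text \<open>
  The value \<open>m = 0\<close> is excluded: it would add the condition \<open>norm f \<le> \<beta> 1 * norm f\<close>, which forces
  \<open>f = 0\<close> whenever \<open>\<beta> 1 < 1\<close>.
\<close>

definition tail_set :: "(nat \<Rightarrow> 'a::complex_inner) \<Rightarrow> (nat \<Rightarrow> real) \<Rightarrow> 'a set" where
  "tail_set e \<beta> =
     {f. \<forall>m\<ge>1. norm (f - orth_proj (cspan (e ` {1..m})) f) \<le> \<beta> (m + 1) * norm f}"

end

theory Submission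
  imports Defs
begin

text \<open>
  After multiplying \<open>f\<close> and \<open>g\<close> by unimodular scalars, their first coefficients \<open>a\<close> and \<open>b\<close> are
  nonnegative, and membership in the tail set forces every later coefficient to be at most
  \<open>\<alpha> n\<^sup>2\<close> times the first. Hence the numbers measured by \<open>\<phi>\<^bsub>n,1\<^esub>\<close> and \<open>\<phi>\<^bsub>n,i\<^esub>\<close> lie in a
  narrow sector around the positive reals, where the modulus nearly coincides with the real part.
  So the two phaseless measurements at \<open>n\<close> recover the real and the imaginary part of the
  difference of the \<open>n\<close>-th coefficients up to an error of order \<open>\<alpha> n * \<bar>a - b\<bar>\<close>, and summing the
  squares by Parseval's identity gives the bound.
\<close>

section \<open>Orthogonal expansions\<close>

lemma cinner_zero_left [simp]: "cinner 0 (z :: 'a::complex_inner) = 0"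
  using cinner_add_left[of 0 0 z] by simp

lemma cinner_diff_left: "cinner (x - y) (z :: 'a::complex_inner) = cinner x z - cinner y z"
  using cinner_add_left[of "x - y" y z] by simp

lemma cinner_sum_left: "cinner (\<Sum>k\<in>F. h k) (z :: 'a::complex_inner) = (\<Sum>k\<in>F. cinner (h k) z)"
  by (induction F rule: infinite_finite_induct) (auto simp: cinner_add_left)

lemma cinner_zero_right [simp]: "cinner (z :: 'a::complex_inner) 0 = 0"
  using cinner_commute[of z 0] by simp

lemma cinner_add_right: "cinner (z :: 'a::complex_inner) (x + y) = cinner z x + cinner z y"
  by (metis cinner_add_left cinner_commute complex_cnj_add)

lemma cinner_scaleC_right: "cinner (x :: 'a::complex_inner) (c *\<^sub>C y) = cnj c * cinner x y"
  by (metis cinner_commute cinner_scaleC_left complex_cnj_mult)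

lemma cinner_sum_right: "cinner (z :: 'a::complex_inner) (\<Sum>k\<in>F. h k) = (\<Sum>k\<in>F. cinner z (h k))"
  by (induction F rule: infinite_finite_induct) (auto simp: cinner_add_right)

text \<open>The class gives homogeneity of the norm for real scalars only; complex scalars are
  reached through \<open>cinner_self\<close>.\<close>

lemma norm_scaleC: "norm (c *\<^sub>C (x :: 'a::complex_inner)) = cmod c * norm x"
proof -
  have "cinner (c *\<^sub>C x) (c *\<^sub>C x) = (c * cnj c) * cinner x x"
    by (simp add: cinner_scaleC_left cinner_scaleC_right)
  then have "complex_of_real ((norm (c *\<^sub>C x))\<^sup>2) = complex_of_real ((cmod c * norm x)\<^sup>2)"
    by (simp only: cinner_self complex_norm_square power_mult_distrib of_real_mult)
  then have "(norm (c *\<^sub>C x))\<^sup>2 = (cmod c * norm x)\<^sup>2"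
    using of_real_eq_iff by blast
  then show ?thesis
    by (simp add: power2_eq_iff_nonneg)
qed

lemma norm_add_orthogonal:
  assumes "cinner (x :: 'a::complex_inner) y = 0"
  shows "(norm (x + y))\<^sup>2 = (norm x)\<^sup>2 + (norm y)\<^sup>2"
proof -
  have "cinner y x = 0"
    using assms cinner_commute[of y x] by simp
  then have "complex_of_real ((norm (x + y))\<^sup>2) = complex_of_real ((norm x)\<^sup>2 + (norm y)\<^sup>2)"
    using assms unfolding of_real_add cinner_self[symmetric]
    by (simp add: cinner_add_left cinner_add_right)
  then show ?thesis
    using of_real_eq_iff by blast
qed

section \<open>Finite Fourier sums, orthogonal projections and Parseval's identity\<close>

definition fourier_sum :: "('k \<Rightarrow> 'a::complex_inner) \<Rightarrow> 'k set \<Rightarrow> 'a \<Rightarrow> 'a" where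
  "fourier_sum e F f = (\<Sum>k\<in>F. cinner f (e k) *\<^sub>C e k)"

context
  fixes I :: "'k set" and e :: "'k \<Rightarrow> 'a::complex_inner"
  assumes onb: "orthonormal_basis I e"
begin

lemma fourier_sum_in_span: "fourier_sum e F f \<in> cspan (e ` F)"
  unfolding fourier_sum_def
  by (intro complex_vector.span_sum complex_vector.span_scale complex_vector.span_base) auto

lemma fourier_residual_orthogonal:
  assumes F: "finite F" "F \<subseteq> I" and v: "v \<in> cspan (e ` F)"
  shows "cinner (f - fourier_sum e F f) v = 0"
  using v
proof (induction rule: complex_vector.span_induct_alt)
  case base
  show ?case by simp
next
  case (step c x y)
  then obtain j where j: "j \<in> F" "x = e j" by auto
  have "cinner (fourier_sum e F f) (e j) = (\<Sum>k\<in>F. if k = j then cinner f (e k) else 0)"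
    unfolding fourier_sum_def cinner_sum_left cinner_scaleC_left
    using onb j F by (intro sum.cong) (auto simp: orthonormal_basis_def subset_iff)
  also have "\<dots> = cinner f (e j)"
    using j F by simp
  finally show ?case
    using step j by (simp add: cinner_add_right cinner_scaleC_right cinner_diff_left)
qed

text \<open>\<open>orth_proj\<close> is a definite description, so uniqueness must be shown too: two
  candidates differ by a vector of the span that is orthogonal to itself.\<close>

lemma orth_proj_eq_fourier_sum:
  assumes F: "finite F" "F \<subseteq> I"
  shows "orth_proj (cspan (e ` F)) f = fourier_sum e F f"
  unfolding orth_proj_def
proof (rule the_equality)
  show "fourier_sum e F f \<in> cspan (e ` F) \<and>
      (\<forall>v\<in>cspan (e ` F). cinner (f - fourier_sum e F f) v = 0)"
    using fourier_sum_in_span fourier_residual_orthogonal[OF F] by blast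
next
  fix p assume p: "p \<in> cspan (e ` F) \<and> (\<forall>v\<in>cspan (e ` F). cinner (f - p) v = 0)"
  let ?q = "fourier_sum e F f"
  have "p - ?q \<in> cspan (e ` F)"
    using p fourier_sum_in_span complex_vector.span_diff by blast
  then have "cinner (f - ?q) (p - ?q) = 0" "cinner (f - p) (p - ?q) = 0"
    using p fourier_residual_orthogonal[OF F] by auto
  then have "cinner (p - ?q) (p - ?q) = 0"
    by (simp add: cinner_diff_left)
  then show "p = ?q"
    by (simp add: cinner_self)
qed

lemma norm_fourier_residual:
  assumes F: "finite F" "F \<subseteq> I"
  shows "(norm (f - fourier_sum e F f))\<^sup>2 = (norm f)\<^sup>2 - (\<Sum>k\<in>F. (cmod (cinner f (e k)))\<^sup>2)"
proof -
  let ?q = "fourier_sum e F f"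
  have orth: "cinner (f - ?q) ?q = 0"
    by (rule fourier_residual_orthogonal[OF F fourier_sum_in_span])
  have "complex_of_real ((norm ?q)\<^sup>2) = cinner f ?q"
    using orth by (simp add: cinner_diff_left cinner_self)
  also have "\<dots> = complex_of_real (\<Sum>k\<in>F. (cmod (cinner f (e k)))\<^sup>2)"
    unfolding fourier_sum_def cinner_sum_right cinner_scaleC_right of_real_sum
    by (simp add: complex_norm_square mult.commute del: of_real_power)
  finally have "(norm ?q)\<^sup>2 = (\<Sum>k\<in>F. (cmod (cinner f (e k)))\<^sup>2)"
    using of_real_eq_iff by blast
  then show ?thesis
    using norm_add_orthogonal[OF orth] by simp
qed

text \<open>The vector \<open>fourier_sum e F f - v\<close> lies in the span, hence is orthogonal to
  the residual, and Pythagoras applies.\<close>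

lemma fourier_sum_best_approx:
  assumes F: "finite F" "F \<subseteq> I" and v: "v \<in> cspan (e ` F)"
  shows "norm (f - fourier_sum e F f) \<le> norm (f - v)"
proof -
  let ?q = "fourier_sum e F f"
  have "cinner (f - ?q) (?q - v) = 0"
    using fourier_residual_orthogonal[OF F] complex_vector.span_diff[OF fourier_sum_in_span v]
    by blast
  from norm_add_orthogonal[OF this]
  have "(norm (f - ?q))\<^sup>2 \<le> (norm (f - v))\<^sup>2" by simp
  then show ?thesis
    by (rule power2_le_imp_le) simp
qed

text \<open>Density provides a finite combination \<open>v\<close> close to \<open>f\<close>. Once
  \<open>F\<close> contains the indices used by \<open>v\<close>, the Fourier sum over
  \<open>F\<close> is at least as close, and its squared error is exactly the gap between the
  partial sum and the claimed limit.\<close>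

lemma parseval: "((\<lambda>k. (cmod (cinner f (e k)))\<^sup>2) has_sum (norm f)\<^sup>2) I"
  unfolding has_sum_def
proof (rule tendstoI)
  fix \<epsilon> :: real assume \<epsilon>: "\<epsilon> > 0"
  have "f \<in> closure (cspan (e ` I))"
    using onb by (simp add: orthonormal_basis_def)
  then obtain v where v: "v \<in> cspan (e ` I)" "dist v f < sqrt \<epsilon>"
    using \<epsilon> by (meson closure_approachable real_sqrt_gt_zero)
  obtain t where t: "finite t" "t \<subseteq> e ` I" "v \<in> cspan t"
    using v(1) unfolding complex_vector.span_explicit[of "e ` I"]
    by (blast intro: complex_vector.span_sum complex_vector.span_scale complex_vector.span_base)
  then obtain G where G: "G \<subseteq> I" "finite G" "t = e ` G"
    using finite_subset_image by metis
  have "dist (\<Sum>k\<in>F. (cmod (cinner f (e k)))\<^sup>2) ((norm f)\<^sup>2) < \<epsilon>"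
    if F: "finite F" "G \<subseteq> F" "F \<subseteq> I" for F
  proof -
    have "v \<in> cspan (e ` F)"
      using t(3) G(3) F(2) complex_vector.span_mono[of "e ` G" "e ` F"] by auto
    then have "norm (f - fourier_sum e F f) \<le> norm (f - v)"
      using F by (intro fourier_sum_best_approx)
    also have "\<dots> < sqrt \<epsilon>"
      using v(2) by (simp add: dist_norm norm_minus_commute)
    finally have "(norm (f - fourier_sum e F f))\<^sup>2 < \<epsilon>"
      using \<epsilon> by (metis norm_ge_zero power_strict_mono zero_less_numeral less_imp_le
          real_sqrt_pow2)
    moreover have "0 \<le> (norm (f - fourier_sum e F f))\<^sup>2" by simp
    ultimately show ?thesis
      unfolding norm_fourier_residual[OF F(1,3)] dist_real_def by linarith
  qed
  then show "\<forall>\<^sub>F F in finite_subsets_at_top I.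
      dist (\<Sum>k\<in>F. (cmod (cinner f (e k)))\<^sup>2) ((norm f)\<^sup>2) < \<epsilon>"
    unfolding eventually_finite_subsets_at_top using G by blast
qed

end

section \<open>Moduli in a narrow sector\<close>

text \<open>Comparing each modulus with its own real part would cost \<epsilon> times
  \<open>cmod z + cmod w\<close>. Treating both together gives an error proportional to
  \<open>cmod (z - w)\<close>, which stability requires.\<close>

lemma modulus_diff_approx_Re:
  fixes z w :: complex
  assumes z: "cmod (z - of_real (cmod z)) \<le> \<epsilon> * cmod z"
    and w: "cmod (w - of_real (cmod w)) \<le> \<epsilon> * cmod w"
  shows "\<bar>(cmod z - cmod w) - Re (z - w)\<bar> \<le> \<epsilon> * cmod (z - w)"
proof (cases "cmod z + cmod w = 0")
  case True
  then have "z = 0" "w = 0"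
    by (smt (verit) norm_ge_zero zero_less_norm_iff)+
  then show ?thesis by simp
next
  case False
  then have pos: "cmod z + cmod w > 0"
    by (smt (verit) norm_ge_zero)
  let ?t = "complex_of_real (cmod z + cmod w)"
  \<comment> \<open>The difference of the squared moduli is
    \<open>Re ((z - w) * cnj (z + w))\<close>; subtracting the real multiple \<open>?t\<close> of
    \<open>Re (z - w)\<close> leaves a factor that is small in the sector.\<close>
  have "(cmod z + cmod w) * ((cmod z - cmod w) - Re (z - w)) =
      Re ((z - w) * cnj ((z + w) - ?t))"
    using cmod_power2[of z] cmod_power2[of w] by (simp add: algebra_simps power2_eq_square)
  then have "(cmod z + cmod w) * \<bar>(cmod z - cmod w) - Re (z - w)\<bar> =
      \<bar>Re ((z - w) * cnj ((z + w) - ?t))\<bar>"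
    using pos by (metis abs_mult abs_of_pos)
  also have "\<dots> \<le> cmod (z - w) * cmod ((z + w) - ?t)"
    by (metis abs_Re_le_cmod complex_mod_cnj norm_mult)
  also have "\<dots> \<le> cmod (z - w) * (\<epsilon> * (cmod z + cmod w))"
  proof (rule mult_left_mono)
    have "(z + w) - ?t = (z - of_real (cmod z)) + (w - of_real (cmod w))" by simp
    then show "cmod ((z + w) - ?t) \<le> \<epsilon> * (cmod z + cmod w)"
      using z w norm_triangle_ineq[of "z - of_real (cmod z)" "w - of_real (cmod w)"]
      by (smt (verit) distrib_left)
  qed simp
  finally have "(cmod z + cmod w) * \<bar>(cmod z - cmod w) - Re (z - w)\<bar> \<le>
      (cmod z + cmod w) * (\<epsilon> * cmod (z - w))"
    by (simp add: mult_ac)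
  then show ?thesis
    using pos mult_le_cancel_left_pos by blast
qed

text \<open>The distance to the modulus is at most twice \<open>cmod u\<close>, so at most
  \<open>r / 100\<close>, while the modulus is at least \<open>199 / 200 * r\<close>; and 2/199 is
  below 1/50.\<close>

lemma near_positive_real:
  fixes u :: complex and r :: real
  assumes r: "0 \<le> r" and u: "cmod u \<le> r / 200"
  shows "cmod ((of_real r + u) - of_real (cmod (of_real r + u))) \<le> 1 / 50 * cmod (of_real r + u)"
proof -
  let ?z = "of_real r + u"
  have 1: "\<bar>cmod ?z - r\<bar> \<le> cmod u"
    using norm_triangle_ineq3[of ?z "of_real r"] r by simp
  have "?z - of_real (cmod ?z) = u + of_real (r - cmod ?z)"
    by simp
  then have "cmod (?z - of_real (cmod ?z)) \<le> cmod u + \<bar>r - cmod ?z\<bar>"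
    by (metis norm_of_real norm_triangle_ineq)
  then show ?thesis
    using 1 u by linarith
qed

text \<open>Here \<open>a\<close>, \<open>b\<close> stand for the first coefficients and
  \<open>u\<close>, \<open>v\<close> for the n-th ones. The two modulus differences approximate the
  real and imaginary parts of \<open>u - v\<close>, each shifted by
  \<open>\<alpha> * (a - b)\<close>.\<close>

lemma coefficient_diff_bound:
  fixes u v :: complex and a b \<alpha> :: real
  assumes ab: "0 \<le> a" "0 \<le> b" and \<alpha>: "0 \<le> \<alpha>" "\<alpha> \<le> 1 / 200"
    and u: "cmod u \<le> \<alpha>\<^sup>2 * a" and v: "cmod v \<le> \<alpha>\<^sup>2 * b"
  shows "(cmod (u - v))\<^sup>2 \<le>
    4 * (cmod (\<alpha> * a + u) - cmod (\<alpha> * b + v))\<^sup>2 +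
    4 * (cmod (\<alpha> * a - \<i> * u) - cmod (\<alpha> * b - \<i> * v))\<^sup>2 + 16 * \<alpha>\<^sup>2 * (a - b)\<^sup>2"
proof -
  \<comment> \<open>One factor \<alpha> is traded for 1/200, which is the smallness needed relative
    to the centre \<open>\<alpha> * c\<close>.\<close>
  have small: "cmod w \<le> \<alpha> * c / 200" if "0 \<le> c" "cmod w \<le> \<alpha>\<^sup>2 * c" for c :: real and w
  proof -
    have "\<alpha>\<^sup>2 * c \<le> (\<alpha> * (1 / 200)) * c"
      unfolding power2_eq_square using that \<alpha> by (intro mult_right_mono mult_left_mono) auto
    then show ?thesis using that by simp
  qed
  have sector: "cmod ((of_real (\<alpha> * c) + w) - of_real (cmod (of_real (\<alpha> * c) + w)))
      \<le> 1 / 50 * cmod (of_real (\<alpha> * c) + w)" if "0 \<le> c" "cmod w \<le> \<alpha>\<^sup>2 * c" for c :: real and w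
    using that \<alpha> small[OF that] by (intro near_positive_real) auto
  define d where "d = u - v"
  define s where "s = \<alpha> * \<bar>a - b\<bar>"
  define p where "p = cmod (\<alpha> * a + u) - cmod (\<alpha> * b + v)"
  define q where "q = cmod (\<alpha> * a - \<i> * u) - cmod (\<alpha> * b - \<i> * v)"
  have s: "\<bar>\<alpha> * (a - b)\<bar> = s"
    using \<alpha> by (simp add: s_def abs_mult)
  have real_part: "\<bar>p - (\<alpha> * (a - b) + Re d)\<bar>
      \<le> 1 / 50 * cmod (of_real (\<alpha> * (a - b)) + d)"
    using modulus_diff_approx_Re[OF sector[OF ab(1) u] sector[OF ab(2) v]]
    by (simp add: p_def d_def algebra_simps)
  have u': "cmod (- (\<i> * u)) \<le> \<alpha>\<^sup>2 * a" and v': "cmod (- (\<i> * v)) \<le> \<alpha>\<^sup>2 * b"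
    using u v by (simp_all add: norm_mult)
  \<comment> \<open>Multiplication by -\<i> turns the imaginary part of \<open>d\<close> into a real
    part.\<close>
  have imag_part: "\<bar>q - (\<alpha> * (a - b) + Im d)\<bar>
      \<le> 1 / 50 * cmod (of_real (\<alpha> * (a - b)) - \<i> * d)"
    using modulus_diff_approx_Re[OF sector[OF ab(1) u'] sector[OF ab(2) v']]
    by (simp add: q_def d_def algebra_simps)
  have deviation: "\<bar>y\<bar> \<le> \<bar>x\<bar> + s + s / 50 + cmod d / 50"
    if "\<bar>x - (h + y)\<bar> \<le> 1 / 50 * c" "\<bar>h\<bar> = s" "c \<le> s + cmod d" for x y h c :: real
    using that by linarith
  have "cmod (of_real (\<alpha> * (a - b)) + d) \<le> s + cmod d"
    using norm_triangle_ineq[of "of_real (\<alpha> * (a - b))" d] s by (simp only: norm_of_real)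
  with real_part s have "\<bar>Re d\<bar> \<le> \<bar>p\<bar> + s + s / 50 + cmod d / 50"
    by (intro deviation)
  moreover have "cmod (of_real (\<alpha> * (a - b)) - \<i> * d) \<le> s + cmod d"
    using norm_triangle_ineq4[of "of_real (\<alpha> * (a - b))" "\<i> * d"] s
    by (simp only: norm_of_real norm_mult norm_ii mult_1)
  with imag_part s have "\<bar>Im d\<bar> \<le> \<bar>q\<bar> + s + s / 50 + cmod d / 50"
    by (intro deviation)
  \<comment> \<open>Adding both bounds puts \<open>4 / 100 * cmod d\<close> on the right, which is
    absorbed on the left.\<close>
  ultimately have "96 * cmod d \<le> 100 * \<bar>p\<bar> + 100 * \<bar>q\<bar> + 204 * s"
    using cmod_le[of d] by linarith
  then have "cmod d \<le> 11 / 10 * (\<bar>p\<bar> + \<bar>q\<bar> + 2 * s)"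
    using s by simp
  then have "(cmod d)\<^sup>2 \<le> (11 / 10 * (\<bar>p\<bar> + \<bar>q\<bar> + 2 * s))\<^sup>2"
    by (intro power_mono) auto
  also have "\<dots> \<le> 4 * \<bar>p\<bar>\<^sup>2 + 4 * \<bar>q\<bar>\<^sup>2 + 16 * s\<^sup>2"
  proof -
    \<comment> \<open>Cauchy-Schwarz for the three terms \<open>\<bar>p\<bar>\<close>,
      \<open>\<bar>q\<bar>\<close>, \<open>2 * s\<close>, as an explicit sum of squares: 3 times
      121/100 is 4 minus 37/100.\<close>
    have "4 * \<bar>p\<bar>\<^sup>2 + 4 * \<bar>q\<bar>\<^sup>2 + 16 * s\<^sup>2 - (11 / 10 * (\<bar>p\<bar> + \<bar>q\<bar> + 2 * s))\<^sup>2 =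
        121 / 100 * ((\<bar>p\<bar> - \<bar>q\<bar>)\<^sup>2 + (\<bar>p\<bar> - 2 * s)\<^sup>2 + (\<bar>q\<bar> - 2 * s)\<^sup>2) +
        37 / 100 * (\<bar>p\<bar>\<^sup>2 + \<bar>q\<bar>\<^sup>2) + 148 / 100 * s\<^sup>2"
      by (simp add: power2_eq_square field_simps)
    also have "\<dots> \<ge> 0"
      by (intro add_nonneg_nonneg mult_nonneg_nonneg) auto
    finally show ?thesis by simp
  qed
  finally show ?thesis
    by (simp add: p_def q_def d_def s_def power_mult_distrib)
qed

section \<open>The frame and its measurements\<close>

lemma has_sum_frame_idxs:
  fixes h :: "frame_idx \<Rightarrow> real"
  assumes re: "((\<lambda>n. h (Re_idx n)) has_sum r) {2..}"
    and im: "((\<lambda>n. h (Im_idx n)) has_sum s) {2..}"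
  shows "(h has_sum (h Base_idx + r + s)) frame_idxs"
  unfolding frame_idxs_def
proof (intro has_sum_Un_disjoint)
  show "(h has_sum h Base_idx) {Base_idx}"
    using has_sum_finite[of "{Base_idx}" h] by simp
  show "(h has_sum r) (Re_idx ` {2..})"
    using re by (subst has_sum_reindex) (auto simp: inj_on_def o_def)
  show "(h has_sum s) (Im_idx ` {2..})"
    using im by (subst has_sum_reindex) (auto simp: inj_on_def o_def)
qed auto

lemma summable_on_frame_idxs_D:
  fixes h :: "frame_idx \<Rightarrow> real"
  assumes "h summable_on frame_idxs"
  shows "(\<lambda>n. h (Re_idx n)) summable_on {2..}" "(\<lambda>n. h (Im_idx n)) summable_on {2..}"
proof -
  have "h summable_on (Re_idx ` {2..})" "h summable_on (Im_idx ` {2..})"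
    using assms by (auto intro: summable_on_subset_banach simp: frame_idxs_def)
  then show "(\<lambda>n. h (Re_idx n)) summable_on {2..}" "(\<lambda>n. h (Im_idx n)) summable_on {2..}"
    by (simp_all add: summable_on_reindex inj_on_def o_def)
qed

lemma sq_norm_add_le: "(norm (x + y))\<^sup>2 \<le> 2 * (norm x)\<^sup>2 + 2 * (norm y)\<^sup>2"
  for x y :: "'a::real_normed_vector"
proof -
  have "(norm (x + y))\<^sup>2 \<le> (norm x + norm y)\<^sup>2"
    by (intro power_mono norm_triangle_ineq norm_ge_zero)
  then show ?thesis
    using zero_le_power2[of "norm x - norm y"] by (simp add: power2_sum power2_diff)
qed

lemma antimono_on_tendsto_zero_nonneg:
  fixes a :: "nat \<Rightarrow> real"
  assumes "antimono_on {k..} a" "a \<longlonglongrightarrow> 0" "n \<ge> k"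
  shows "0 \<le> a n"
proof (rule LIMSEQ_le_const2[OF assms(2)])
  show "\<exists>N. \<forall>j\<ge>N. a j \<le> a n"
    using assms(1,3) by (intro exI[of _ n]) (auto simp: monotone_on_def)
qed

section \<open>Weights, measurements and the frame bounds\<close>

context
  fixes e :: "nat \<Rightarrow> 'a::complex_inner" and \<alpha> :: "nat \<Rightarrow> real"
  assumes onb: "orthonormal_basis {1..} e"
    and nonneg: "\<And>n. n \<ge> 2 \<Longrightarrow> 0 \<le> \<alpha> n"
    and summable: "\<alpha> summable_on {2..}" and small: "(\<Sum>\<^sub>\<infinity>n\<in>{2..}. \<alpha> n) < 1 / 200"
begin

lemma weight_le: "n \<ge> 2 \<Longrightarrow> \<alpha> n \<le> 1 / 200"
  using finite_sum_le_infsum[OF summable, of "{n}"] nonneg small by auto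

lemma sq_weights_summable: "(\<lambda>n. (\<alpha> n)\<^sup>2) summable_on {2..}"
  and sq_weights_infsum: "(\<Sum>\<^sub>\<infinity>n\<in>{2..}. (\<alpha> n)\<^sup>2) \<le> 1 / 40000"
proof -
  \<comment> \<open>Each weight is at most 1/200, so the squares sum to at most 1/200
    squared.\<close>
  have le: "(\<alpha> n)\<^sup>2 \<le> \<alpha> n * (1 / 200)" if "n \<in> {2..}" for n
    using that nonneg[of n] weight_le[of n] unfolding power2_eq_square
    by (intro mult_left_mono) auto
  show s: "(\<lambda>n. (\<alpha> n)\<^sup>2) summable_on {2..}"
    by (rule summable_on_comparison_test[OF summable_on_cmult_left[OF summable] le]) auto
  have "(\<Sum>\<^sub>\<infinity>n\<in>{2..}. (\<alpha> n)\<^sup>2) \<le> (\<Sum>\<^sub>\<infinity>n\<in>{2..}. \<alpha> n * (1 / 200))"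
    by (rule infsum_mono[OF s summable_on_cmult_left[OF summable] le])
  also have "\<dots> = (\<Sum>\<^sub>\<infinity>n\<in>{2..}. \<alpha> n) * (1 / 200)"
    by (rule infsum_cmult_left')
  finally show "(\<Sum>\<^sub>\<infinity>n\<in>{2..}. (\<alpha> n)\<^sup>2) \<le> 1 / 40000"
    using small by simp
qed

lemma parseval_tail:
  "((\<lambda>n. (cmod (cinner f (e n)))\<^sup>2) has_sum ((norm f)\<^sup>2 - (cmod (cinner f (e 1)))\<^sup>2)) {2..}"
proof -
  have "((\<lambda>n. (cmod (cinner f (e n)))\<^sup>2) has_sum ((norm f)\<^sup>2 - (cmod (cinner f (e 1)))\<^sup>2))
      ({1..} - {1})"
    using has_sum_finite[of "{1}" "\<lambda>n. (cmod (cinner f (e n)))\<^sup>2"]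
    by (intro has_sum_Diff parseval[OF onb]) auto
  moreover have "{1..} - {1::nat} = {2..}" by auto
  ultimately show ?thesis by simp
qed

text \<open>The minus sign comes from conjugate linearity in the second argument.\<close>

lemma cinner_frame_vec:
  "cinner f (frame_vec e \<alpha> (Re_idx n)) = of_real (\<alpha> n) * cinner f (e 1) + cinner f (e n)"
  "cinner f (frame_vec e \<alpha> (Im_idx n)) = of_real (\<alpha> n) * cinner f (e 1) - \<i> * cinner f (e n)"
  by (simp_all add: cinner_add_right cinner_scaleC_right)

text \<open>The vectors perturb an orthonormal basis along \<open>e 1\<close> by square-summable
  weights, so Parseval gives both bounds up to multiples of \<open>A * X\<close>, with
  \<open>A\<close> tiny.\<close>

lemma is_frame_frame_vec: "is_frame frame_idxs (frame_vec e \<alpha>)"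
proof -
  have "(\<lambda>k. (cmod (cinner f (frame_vec e \<alpha> k)))\<^sup>2) summable_on frame_idxs \<and>
      1 / 2 * (norm f)\<^sup>2 \<le> (\<Sum>\<^sub>\<infinity>k\<in>frame_idxs. (cmod (cinner f (frame_vec e \<alpha> k)))\<^sup>2) \<and>
      (\<Sum>\<^sub>\<infinity>k\<in>frame_idxs. (cmod (cinner f (frame_vec e \<alpha> k)))\<^sup>2) \<le> 5 * (norm f)\<^sup>2" for f
  proof -
    define x where "x n = cinner f (e n)" for n
    define m where "m k = (cmod (cinner f (frame_vec e \<alpha> k)))\<^sup>2" for k
    define A where "A = (\<Sum>\<^sub>\<infinity>n\<in>{2..}. (\<alpha> n)\<^sup>2)"
    define X where "X = (cmod (x 1))\<^sup>2"
    have m: "m Base_idx = X" "m (Re_idx n) = (cmod (\<alpha> n * x 1 + x n))\<^sup>2"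
      "m (Im_idx n) = (cmod (\<alpha> n * x 1 - \<i> * x n))\<^sup>2" for n
      unfolding m_def cinner_frame_vec x_def X_def by simp_all
    have A: "((\<lambda>n. (\<alpha> n)\<^sup>2) has_sum A) {2..}" "A \<le> 1 / 40000" "0 \<le> A"
      unfolding A_def using sq_weights_summable sq_weights_infsum
      by (auto intro: infsum_nonneg)
    have tail: "((\<lambda>n. (cmod (x n))\<^sup>2) has_sum ((norm f)\<^sup>2 - X)) {2..}"
      using parseval_tail[of f] by (simp add: x_def X_def)
    then have X_le: "X \<le> (norm f)\<^sup>2"
      using has_sum_nonneg[OF tail] by simp
    have "0 \<le> X"
      by (simp add: X_def)
    then have AX: "0 \<le> A * X" "A * X \<le> 1 / 40000 * X"
      by (intro mult_nonneg_nonneg mult_right_mono A; assumption)+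
    have dominating: "((\<lambda>n. 2 * ((\<alpha> n)\<^sup>2 * X) + 2 * (cmod (x n))\<^sup>2) has_sum
        (2 * (A * X) + 2 * ((norm f)\<^sup>2 - X))) {2..}"
      by (intro has_sum_add has_sum_cmult_right has_sum_cmult_left A tail)
    have weight: "(cmod (\<alpha> n * x 1))\<^sup>2 = (\<alpha> n)\<^sup>2 * X" for n
      by (simp add: norm_mult power_mult_distrib X_def)
    have re_le: "m (Re_idx n) \<le> 2 * ((\<alpha> n)\<^sup>2 * X) + 2 * (cmod (x n))\<^sup>2" for n
      using sq_norm_add_le[of "\<alpha> n * x 1" "x n"] by (simp only: m weight)
    have im_le: "m (Im_idx n) \<le> 2 * ((\<alpha> n)\<^sup>2 * X) + 2 * (cmod (x n))\<^sup>2" for n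
      using sq_norm_add_le[of "\<alpha> n * x 1" "- (\<i> * x n)"]
      unfolding weight by (simp add: m norm_mult)
    have m_nonneg: "0 \<le> m k" for k
      by (simp add: m_def)
    obtain R where R: "((\<lambda>n. m (Re_idx n)) has_sum R) {2..}"
      using summable_on_comparison_test[OF has_sum_imp_summable[OF dominating] re_le m_nonneg]
      by (auto simp: summable_on_def)
    obtain J where J: "((\<lambda>n. m (Im_idx n)) has_sum J) {2..}"
      using summable_on_comparison_test[OF has_sum_imp_summable[OF dominating] im_le m_nonneg]
      by (auto simp: summable_on_def)
    have R_le: "R \<le> 2 * (A * X) + 2 * ((norm f)\<^sup>2 - X)"
      by (rule has_sum_mono[OF R dominating re_le])
    have J_le: "J \<le> 2 * (A * X) + 2 * ((norm f)\<^sup>2 - X)"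
      by (rule has_sum_mono[OF J dominating im_le])
    have J_nonneg: "0 \<le> J"
      by (rule has_sum_nonneg[OF J m_nonneg])
    \<comment> \<open>Lower bound: the n-th coefficient is the measured number minus
      \<open>\<alpha> n * x 1\<close>.\<close>
    have "(cmod (x n))\<^sup>2 \<le> 2 * m (Re_idx n) + 2 * ((\<alpha> n)\<^sup>2 * X)" for n
      using sq_norm_add_le[of "\<alpha> n * x 1 + x n" "- (\<alpha> n * x 1)"]
      unfolding norm_minus_cancel weight by (simp add: m)
    moreover have "((\<lambda>n. 2 * m (Re_idx n) + 2 * ((\<alpha> n)\<^sup>2 * X)) has_sum (2 * R + 2 * (A * X))) {2..}"
      by (intro has_sum_add has_sum_cmult_right[OF R] has_sum_cmult_right has_sum_cmult_left A)
    ultimately have tail_le: "(norm f)\<^sup>2 - X \<le> 2 * R + 2 * (A * X)"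
      using has_sum_mono[OF tail] by blast
    have "(m has_sum (X + R + J)) frame_idxs"
      using has_sum_frame_idxs[OF R J] m(1) by simp
    moreover have "1 / 2 * (norm f)\<^sup>2 \<le> X + R + J"
      using tail_le AX X_le J_nonneg by (simp add: X_def)
    moreover have "X + R + J \<le> 5 * (norm f)\<^sup>2"
      using R_le J_le AX X_le \<open>0 \<le> X\<close> unfolding right_diff_distrib by linarith
    ultimately show ?thesis
      unfolding m_def by (auto simp: infsumI has_sum_imp_summable)
  qed
  then show ?thesis
    unfolding is_frame_def by (intro exI[of _ "1 / 2"] exI[of _ 5] conjI allI) auto
qed

section \<open>Stability for vectors with normalised phase\<close>

lemma norm_diff_le_ell2_norm:
  assumes f: "cinner f (e 1) = of_real a" "0 \<le> a"
    and f_tail: "\<And>n. n \<ge> 2 \<Longrightarrow> cmod (cinner f (e n)) \<le> (\<alpha> n)\<^sup>2 * a"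
    and g: "cinner g (e 1) = of_real b" "0 \<le> b"
    and g_tail: "\<And>n. n \<ge> 2 \<Longrightarrow> cmod (cinner g (e n)) \<le> (\<alpha> n)\<^sup>2 * b"
  shows "norm (f - g) \<le>
    5 * ell2_norm frame_idxs (\<lambda>k. meas (frame_vec e \<alpha>) f k - meas (frame_vec e \<alpha>) g k)"
proof -
  define D where "D k = (meas (frame_vec e \<alpha>) f k - meas (frame_vec e \<alpha>) g k)\<^sup>2" for k
  define A where "A = (\<Sum>\<^sub>\<infinity>n\<in>{2..}. (\<alpha> n)\<^sup>2)"
  have A: "((\<lambda>n. (\<alpha> n)\<^sup>2) has_sum A) {2..}" "A \<le> 1 / 40000"
    unfolding A_def using sq_weights_summable sq_weights_infsum by auto
  have "D summable_on frame_idxs"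
    unfolding D_def by (rule frame_meas_diff_square_summable[OF is_frame_frame_vec])
  from summable_on_frame_idxs_D[OF this] obtain R J
    where R: "((\<lambda>n. D (Re_idx n)) has_sum R) {2..}"
      and J: "((\<lambda>n. D (Im_idx n)) has_sum J) {2..}"
    by (auto simp: summable_on_def)
  have "D Base_idx = (a - b)\<^sup>2"
    using f g by (simp add: D_def meas_def)
  then have D_sum: "(\<Sum>\<^sub>\<infinity>k\<in>frame_idxs. D k) = (a - b)\<^sup>2 + R + J"
    using infsumI[OF has_sum_frame_idxs[of D, OF R J]] by simp
  have RJ: "0 \<le> R" "0 \<le> J"
    using has_sum_nonneg[OF R] has_sum_nonneg[OF J] by (auto simp: D_def)
  have "cinner (f - g) (e 1) = of_real (a - b)"
    using f g by (simp add: cinner_diff_left)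
  then have "(cmod (cinner (f - g) (e 1)))\<^sup>2 = (a - b)\<^sup>2"
    by (simp only: norm_of_real power2_abs)
  then have tail: "((\<lambda>n. (cmod (cinner (f - g) (e n)))\<^sup>2) has_sum ((norm (f - g))\<^sup>2 - (a - b)\<^sup>2)) {2..}"
    using parseval_tail[of "f - g"] by simp
  have "(norm (f - g))\<^sup>2 - (a - b)\<^sup>2 \<le> 4 * R + 4 * J + 16 * A * (a - b)\<^sup>2"
  proof (rule has_sum_mono[OF tail])
    show "((\<lambda>n. 4 * D (Re_idx n) + 4 * D (Im_idx n) + 16 * (\<alpha> n)\<^sup>2 * (a - b)\<^sup>2) has_sum
        (4 * R + 4 * J + 16 * A * (a - b)\<^sup>2)) {2..}"
      by (intro has_sum_add has_sum_cmult_right has_sum_cmult_left A R J)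
    fix n :: nat assume "n \<in> {2..}"
    then have n: "n \<ge> 2" by simp
    show "(cmod (cinner (f - g) (e n)))\<^sup>2 \<le>
        4 * D (Re_idx n) + 4 * D (Im_idx n) + 16 * (\<alpha> n)\<^sup>2 * (a - b)\<^sup>2"
      using coefficient_diff_bound[OF f(2) g(2) nonneg[OF n] weight_le[OF n] f_tail[OF n] g_tail[OF n]]
      unfolding D_def meas_def cinner_frame_vec cinner_diff_left f(1) g(1) of_real_mult .
  qed
  \<comment> \<open>The errors in all coefficients together cost at most one more
    \<open>(a - b)\<^sup>2\<close>, which the base measurement controls.\<close>
  moreover have "16 * A * (a - b)\<^sup>2 \<le> 1 * (a - b)\<^sup>2"
    using A by (intro mult_right_mono) auto
  ultimately have "(norm (f - g))\<^sup>2 \<le> 25 * ((a - b)\<^sup>2 + R + J)"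
    using RJ zero_le_power2[of "a - b"] unfolding distrib_left by linarith
  then have "norm (f - g) \<le> sqrt (5\<^sup>2 * ((a - b)\<^sup>2 + R + J))"
    by (intro real_le_rsqrt) simp
  also have "\<dots> = 5 * ell2_norm frame_idxs (\<lambda>k. meas (frame_vec e \<alpha>) f k - meas (frame_vec e \<alpha>) g k)"
    using D_sum by (simp only: real_sqrt_mult ell2_norm_def D_def) simp
  finally show ?thesis .
qed

section \<open>Coefficients of tail set vectors and the choice of phase\<close>

text \<open>The tail condition at m = 1 makes \<open>norm f\<close> at most twice the first
  coefficient; at m = n - 1 it bounds the n-th. The 2 cancels the 1/2 in the bound on
  \<beta>.\<close>

lemma tail_set_coefficients:
  assumes f: "f \<in> tail_set e \<beta>" and \<beta>: "\<And>n. n \<ge> 1 \<Longrightarrow> \<beta> n < (\<alpha> n)\<^sup>2 / 2" and n: "n \<ge> 2"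
  shows "cmod (cinner f (e n)) \<le> (\<alpha> n)\<^sup>2 * cmod (cinner f (e 1))"
proof -
  have residual: "norm (f - fourier_sum e {1..m} f) \<le> (\<alpha> (m + 1))\<^sup>2 / 2 * norm f" if "m \<ge> 1" for m
  proof -
    have "norm (f - fourier_sum e {1..m} f) \<le> \<beta> (m + 1) * norm f"
      using f that orth_proj_eq_fourier_sum[OF onb, of "{1..m}" f] by (auto simp: tail_set_def)
    also have "\<dots> \<le> (\<alpha> (m + 1))\<^sup>2 / 2 * norm f"
      using \<beta>[of "m + 1"] by (intro mult_right_mono) auto
    finally show ?thesis .
  qed
  have norm_le: "norm f \<le> 2 * cmod (cinner f (e 1))"
  proof -
    have "(\<alpha> 2)\<^sup>2 \<le> 1"
      using nonneg[of 2] weight_le[of 2] by (intro power_le_one) auto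
    then have "(\<alpha> 2)\<^sup>2 / 2 * norm f \<le> 1 / 2 * norm f"
      by (intro mult_right_mono) auto
    moreover have "norm (f - fourier_sum e {1..1} f) \<le> (\<alpha> 2)\<^sup>2 / 2 * norm f"
      using residual[of 1] by (simp add: numeral_2_eq_2)
    ultimately have "(norm (f - fourier_sum e {1..1} f))\<^sup>2 \<le> (1 / 2 * norm f)\<^sup>2"
      by (intro power_mono) auto
    \<comment> \<open>The residual after \<open>e 1\<close> carries at most a quarter of the squared
      norm.\<close>
    then have "3 * (norm f)\<^sup>2 \<le> 4 * (cmod (cinner f (e 1)))\<^sup>2"
      using norm_fourier_residual[OF onb, of "{1..1}" f] by (simp add: power2_eq_square)
    moreover have "(2 * cmod (cinner f (e 1)))\<^sup>2 = 4 * (cmod (cinner f (e 1)))\<^sup>2"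
      by (simp add: power_mult_distrib)
    ultimately have "(norm f)\<^sup>2 \<le> (2 * cmod (cinner f (e 1)))\<^sup>2"
      using zero_le_power2[of "norm f"] by linarith
    then show ?thesis
      by (rule power2_le_imp_le) simp
  qed
  obtain m where m: "n = m + 1" "m \<ge> 1"
    using n by (metis add_leD2 le_add_diff_inverse2 one_add_one le_diff_conv2 add.commute)
  have "(\<Sum>k\<in>{1..n}. (cmod (cinner f (e k)))\<^sup>2) \<le> (norm f)\<^sup>2"
    using norm_fourier_residual[OF onb, of "{1..n}" f] zero_le_power2[of "norm (f - fourier_sum e {1..n} f)"]
    by simp
  then have "(cmod (cinner f (e n)))\<^sup>2 \<le> (norm (f - fourier_sum e {1..m} f))\<^sup>2"
    using norm_fourier_residual[OF onb, of "{1..m}" f] m by simp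
  then have "cmod (cinner f (e n)) \<le> norm (f - fourier_sum e {1..m} f)"
    by (rule power2_le_imp_le) simp
  also have "\<dots> \<le> (\<alpha> n)\<^sup>2 / 2 * norm f"
    using residual[OF m(2)] m(1) by simp
  also have "\<dots> \<le> (\<alpha> n)\<^sup>2 / 2 * (2 * cmod (cinner f (e 1)))"
    by (intro mult_left_mono norm_le) simp
  finally show ?thesis by simp
qed

text \<open>Unimodular factors leave the measurements and the tail estimates unchanged, so
  \<open>f\<close> and \<open>g\<close> may be rotated to nonnegative first coefficients.\<close>

lemma INF_norm_diff_le_ell2_norm:
  assumes f: "f \<in> tail_set e \<beta>" and g: "g \<in> tail_set e \<beta>"
    and \<beta>: "\<And>n. n \<ge> 1 \<Longrightarrow> \<beta> n < (\<alpha> n)\<^sup>2 / 2"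
  shows "(INF c\<in>{c :: complex. cmod c = 1}. norm (f - c *\<^sub>C g)) \<le>
    5 * ell2_norm frame_idxs (\<lambda>k. meas (frame_vec e \<alpha>) f k - meas (frame_vec e \<alpha>) g k)"
proof -
  have phase: "\<exists>s. cmod s = 1 \<and> s * z = of_real (cmod z)" for z :: complex
  proof (cases "z = 0")
    case False
    then show ?thesis
      by (intro exI[of _ "of_real (cmod z) / z"]) (simp add: norm_divide)
  qed (auto intro: exI[of _ 1])
  obtain s where s: "cmod s = 1" "s * cinner f (e 1) = of_real (cmod (cinner f (e 1)))"
    using phase by blast
  obtain t where t: "cmod t = 1" "t * cinner g (e 1) = of_real (cmod (cinner g (e 1)))"
    using phase by blast
  have s0: "s \<noteq> 0"
    using s(1) by auto
  have meas: "meas (frame_vec e \<alpha>) (s *\<^sub>C f) = meas (frame_vec e \<alpha>) f"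
    "meas (frame_vec e \<alpha>) (t *\<^sub>C g) = meas (frame_vec e \<alpha>) g"
    using s t by (auto simp: meas_def cinner_scaleC_left norm_mult)
  \<comment> \<open>Undoing the rotation of \<open>f\<close> shows that \<open>t / s\<close> is the
    unimodular witness for the infimum.\<close>
  have "s *\<^sub>C (f - (t / s) *\<^sub>C g) = s *\<^sub>C f - t *\<^sub>C g"
    using s0 by (simp add: complex_vector.scale_right_diff_distrib scaleC_scaleC)
  then have "norm (f - (t / s) *\<^sub>C g) = norm (s *\<^sub>C f - t *\<^sub>C g)"
    using norm_scaleC[of s "f - (t / s) *\<^sub>C g"] s(1) by simp
  also have "\<dots> \<le> 5 * ell2_norm frame_idxs
      (\<lambda>k. meas (frame_vec e \<alpha>) (s *\<^sub>C f) k - meas (frame_vec e \<alpha>) (t *\<^sub>C g) k)"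
    using s t tail_set_coefficients[OF f \<beta>] tail_set_coefficients[OF g \<beta>]
    by (intro norm_diff_le_ell2_norm[of "s *\<^sub>C f" "cmod (cinner f (e 1))" "t *\<^sub>C g"
          "cmod (cinner g (e 1))"])
      (simp_all add: cinner_scaleC_left norm_mult)
  finally have "norm (f - (t / s) *\<^sub>C g) \<le>
      5 * ell2_norm frame_idxs (\<lambda>k. meas (frame_vec e \<alpha>) f k - meas (frame_vec e \<alpha>) g k)"
    by (simp only: meas)
  moreover have "(INF c\<in>{c :: complex. cmod c = 1}. norm (f - c *\<^sub>C g)) \<le> norm (f - (t / s) *\<^sub>C g)"
    using s t by (intro cINF_lower bdd_belowI2[of _ 0]) (auto simp: norm_divide)
  ultimately show ?thesis by linarith
qed

end

theorem theorem3p2: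
  fixes e :: "nat \<Rightarrow> 'a::chilbert_space"
    and \<alpha> \<beta> :: "nat \<Rightarrow> real"
  assumes e: "orthonormal_basis {1..} e"
    and \<alpha>_decreasing: "antimono_on {1..} \<alpha>" "\<alpha> \<longlonglongrightarrow> 0"
    and \<alpha>_sum: "\<alpha> summable_on {2..}" "(\<Sum>\<^sub>\<infinity>n\<in>{2..}. \<alpha> n) < 1 / 200"
    and \<beta>_decreasing: "antimono_on {1..} \<beta>" "\<beta> \<longlonglongrightarrow> 0"
    and \<beta>_less: "\<And>n. n \<ge> 1 \<Longrightarrow> \<beta> n < (\<alpha> n)\<^sup>2 / 2"
  shows "is_frame frame_idxs (frame_vec e \<alpha>) \<and>
    (\<forall>f\<in>tail_set e \<beta>. \<forall>g\<in>tail_set e \<beta>.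
       (INF c\<in>{c :: complex. cmod c = 1}. norm (f - c *\<^sub>C g)) \<le>
         5 * ell2_norm frame_idxs (\<lambda>k. meas (frame_vec e \<alpha>) f k - meas (frame_vec e \<alpha>) g k))"
proof -
  \<comment> \<open>A sequence decreasing to 0 cannot become negative, as it would then stay below
    that negative value.\<close>
  have nonneg: "0 \<le> \<alpha> n" if "n \<ge> 2" for n
    using antimono_on_tendsto_zero_nonneg[OF \<alpha>_decreasing, of n] that by simp
  show ?thesis
    using is_frame_frame_vec[OF e nonneg \<alpha>_sum]
      INF_norm_diff_le_ell2_norm[OF e nonneg \<alpha>_sum _ _ \<beta>_less]
    by blast
qed

end
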